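(* Let $k\ge1$, $g\ge1$ and $t\ge k$ be integers, $p\in(0,1)$, $q=1-p$. For $n\ge 1$ let $f(n,t)=P(L_n\ge t)$, where $L_n$ is the length of the longest success run (of order $k$ with gap $g$) in $n$ independent Bernoulli trials with success probability $p$ ($L_n=0$ if there is no success run), and set $f(n,t)=0$ for all integers $n\le 0$. Then for every $n>t$, $$f(n,t)=q\sum_{i=0}^{k-1}p^i f(n-i-1,t)+q\sum_{i=k}^{t-1}p^i f(n-i-g,t)+p^t,$$ with the initial conditions $f(t,t)=p^t$ and $f(n,t)=0$ for $-\infty<n<t$.
   Context: Consider a sequence of $n$ independent trials, each $S$ (success) with probability $p$ or $F$ (failure) with probability $q=1-p$. The success runs (of order $k$ with gap $g$) are defined inductively. The first success run (if it exists) is the first run of at least $k$ consecutive successes, taken maximal (it cannot be extended to a longer run). A success run terminates at trial $m$ if trial $m$ is its last success, i.e. either $m=n$ or trial $m+1$ is a failure. If the $j$-th success run terminates at trial $m$, then the $(j+1)$-th success run (if it exists) is the first run of at least $k$ consecutive successes which begins later than trial $m+g$, taken maximal among runs beginning later than trial $m+g$ (trials $m+1,\dots,m+g$ form the gap: an $F$ followed by $g-1$ arbitrary outcomes). *)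

theory Defs
  imports "HOL-Probability.Product_PMF"
begin

text \<open>
  An outcome of \<open>n\<close> trials is a function \<open>x :: nat \<Rightarrow> bool\<close> read on the indices \<open>1, \<dots>, n\<close>;
  \<open>x i\<close> means that trial \<open>i\<close> is a success.
\<close>

definition late_run :: "nat \<Rightarrow> nat \<Rightarrow> (nat \<Rightarrow> bool) \<Rightarrow> nat \<Rightarrow> nat \<Rightarrow> nat \<Rightarrow> bool" where
  \<comment> \<open>trials \<open>a, \<dots>, b\<close> form a run of at least \<open>k\<close> consecutive successes beginning later than
      trial \<open>r\<close>\<close>
  "late_run k n x r a b \<longleftrightarrow>
     1 \<le> a \<and> a \<le> b \<and> b \<le> n \<and> (\<forall>i\<in>{a..b}. x i) \<and> k \<le> card {a..b} \<and> r < a"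

definition maximal_late_run :: "nat \<Rightarrow> nat \<Rightarrow> (nat \<Rightarrow> bool) \<Rightarrow> nat \<Rightarrow> nat \<Rightarrow> nat \<Rightarrow> bool" where
  \<comment> \<open>maximal only among the runs beginning later than \<open>r\<close>: trial \<open>r\<close> itself may be a success
      immediately preceding the run\<close>
  "maximal_late_run k n x r a b \<longleftrightarrow>
     late_run k n x r a b \<and> (\<nexists>a' b'. late_run k n x r a' b' \<and> {a..b} \<subset> {a'..b'})"

definition first_late_run :: "nat \<Rightarrow> nat \<Rightarrow> (nat \<Rightarrow> bool) \<Rightarrow> nat \<Rightarrow> nat \<Rightarrow> nat \<Rightarrow> bool" where
  "first_late_run k n x r a b \<longleftrightarrow>
     maximal_late_run k n x r a b \<and> (\<forall>a' b'. maximal_late_run k n x r a' b' \<longrightarrow> a \<le> a')"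

text \<open>
  \<open>success_run k g n x j a b\<close>: the \<open>j\<close>-th success run of order \<open>k\<close> with gap \<open>g\<close> exists and consists
  of the trials \<open>a, \<dots>, b\<close>; in particular it terminates at trial \<open>b\<close>.
\<close>

inductive success_run ::
  "nat \<Rightarrow> nat \<Rightarrow> nat \<Rightarrow> (nat \<Rightarrow> bool) \<Rightarrow> nat \<Rightarrow> nat \<Rightarrow> nat \<Rightarrow> bool"
  for k g n :: nat and x :: "nat \<Rightarrow> bool" where
  first: "first_late_run k n x 0 a b \<Longrightarrow> success_run k g n x 1 a b"
| step: "success_run k g n x j a m \<Longrightarrow> first_late_run k n x (m + g) a' b' \<Longrightarrow>
    success_run k g n x (Suc j) a' b'"

definition longest_run :: "nat \<Rightarrow> nat \<Rightarrow> nat \<Rightarrow> (nat \<Rightarrow> bool) \<Rightarrow> nat" where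
  "longest_run k g n x = Max (insert 0 {card {a..b} | j a b. success_run k g n x j a b})"

definition bernoulli_trials :: "real \<Rightarrow> nat \<Rightarrow> (nat \<Rightarrow> bool) pmf" where
  \<comment> \<open>the product distribution; \<open>False\<close> is only the dummy value at indices outside \<open>{1..n}\<close>\<close>
  "bernoulli_trials p n = Pi_pmf {1..n} False (\<lambda>_. bernoulli_pmf p)"

definition run_prob :: "real \<Rightarrow> nat \<Rightarrow> nat \<Rightarrow> int \<Rightarrow> nat \<Rightarrow> real" where
  "run_prob p k g n t =
     (if n \<le> 0 then 0
      else measure_pmf.prob (bernoulli_trials p (nat n)) {x. longest_run k g (nat n) x \<ge> t})"

end

theory Submission
  imports Defs
begin

text \<open>
  Condition on the position \<open>i + 1\<close> of the first failure. For \<open>i < k\<close> no success run meets the first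
  \<open>i + 1\<close> trials, so the process starts afresh after trial \<open>i + 1\<close>. For \<open>k \<le> i < t\<close> the first success
  run is \<open>1, \<dots>, i\<close>, which is too short, and the process starts afresh after the gap, so after trial
  \<open>i + g\<close>. If the first \<open>t\<close> trials are all successes, the first success run has length at least \<open>t\<close>.
\<close>

section \<open>Translation of runs by a shift of the trials\<close>

lemma late_run_shift:
  "late_run k n x (r + s) (a + s) (b + s) \<longleftrightarrow> late_run k (n - s) (\<lambda>i. x (i + s)) r a b"
proof -
  have "(\<forall>i\<in>{a + s..b + s}. x i) \<longleftrightarrow> (\<forall>i\<in>{a..b}. x (i + s))"
    by (simp flip: image_add_atLeastAtMost')
  then show ?thesis
    unfolding late_run_def by auto
qed

text \<open>Runs are nonempty, so strict inclusion of intervals becomes a comparison of endpoints, a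
  form that is invariant under adding \<open>s\<close>.\<close>

lemma maximal_late_run_alt:
  "maximal_late_run k n x r a b \<longleftrightarrow> late_run k n x r a b \<and>
     (\<forall>a' b'. late_run k n x r a' b' \<longrightarrow> a' \<le> a \<longrightarrow> b \<le> b' \<longrightarrow> a' = a \<and> b' = b)"
proof -
  have "{a..b} \<subset> {a'..b'} \<longleftrightarrow> a' \<le> a \<and> b \<le> b' \<and> \<not> (a' = a \<and> b' = b)"
    if "late_run k n x r a b" for a' b'
    using that by (auto simp: psubset_eq Icc_eq_Icc late_run_def)
  then show ?thesis
    unfolding maximal_late_run_def by metis
qed

lemma maximal_late_run_imp_late_run: "maximal_late_run k n x r a b \<Longrightarrow> late_run k n x r a b"
  by (simp add: maximal_late_run_def)

lemma late_run_ge: "late_run k n x (r + s) a b \<Longrightarrow> s \<le> a \<and> s \<le> b"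
  by (auto simp: late_run_def)

text \<open>Adding \<open>s\<close> is not onto the naturals; the reindexing is valid because
  \<open>L\<close> holds only of endpoints that are at least \<open>s\<close>.\<close>

lemma all_ge_shift:
  fixes s :: nat
  assumes "\<And>a b. L a b \<Longrightarrow> s \<le> a \<and> s \<le> b"
  shows "(\<forall>a b. L a b \<longrightarrow> P a b) \<longleftrightarrow> (\<forall>a b. L (a + s) (b + s) \<longrightarrow> P (a + s) (b + s))"
    (is "_ \<longleftrightarrow> ?R")
proof
  assume R: ?R
  show "\<forall>a b. L a b \<longrightarrow> P a b"
  proof (intro allI impI)
    fix a b assume "L a b"
    with assms[OF this] R[rule_format, of "a - s" "b - s"] show "P a b"
      by simp
  qed
qed simp

lemma all_late_run_shift:
  "(\<forall>a b. late_run k n x (r + s) a b \<longrightarrow> P a b) \<longleftrightarrow>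
   (\<forall>a b. late_run k (n - s) (\<lambda>i. x (i + s)) r a b \<longrightarrow> P (a + s) (b + s))"
  using all_ge_shift[of "late_run k n x (r + s)" s P, OF late_run_ge] unfolding late_run_shift .

lemma maximal_late_run_shift:
  "maximal_late_run k n x (r + s) (a + s) (b + s) \<longleftrightarrow>
   maximal_late_run k (n - s) (\<lambda>i. x (i + s)) r a b"
  unfolding maximal_late_run_alt late_run_shift all_late_run_shift by simp

lemma all_maximal_late_run_shift:
  "(\<forall>a b. maximal_late_run k n x (r + s) a b \<longrightarrow> P a b) \<longleftrightarrow>
   (\<forall>a b. maximal_late_run k (n - s) (\<lambda>i. x (i + s)) r a b \<longrightarrow> P (a + s) (b + s))"
  using all_ge_shift[of "maximal_late_run k n x (r + s)" s P,
      OF late_run_ge[OF maximal_late_run_imp_late_run]]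
  unfolding maximal_late_run_shift .

lemma first_late_run_shift:
  "first_late_run k n x (r + s) (a + s) (b + s) \<longleftrightarrow>
   first_late_run k (n - s) (\<lambda>i. x (i + s)) r a b"
  unfolding first_late_run_def maximal_late_run_shift all_maximal_late_run_shift by simp

lemma first_late_run_imp_late_run: "first_late_run k n x r a b \<Longrightarrow> late_run k n x r a b"
  by (simp add: first_late_run_def maximal_late_run_imp_late_run)

section \<open>Uniqueness and location of the first run\<close>

text \<open>Minimality fixes the left endpoint. Two runs with a common left endpoint are nested, so
  maximality makes them equal.\<close>

lemma first_late_run_unique:
  assumes "first_late_run k n x r a b" "first_late_run k n x r a' b'"
  shows "a = a' \<and> b = b'"
proof -
  have m: "maximal_late_run k n x r a b" "maximal_late_run k n x r a' b'"
    using assms by (auto simp: first_late_run_def)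
  have "a = a'"
    using assms m by (meson first_late_run_def antisym)
  with m show ?thesis
    unfolding maximal_late_run_alt by (metis order_refl nat_le_linear)
qed

lemma first_late_run_initial:
  assumes "1 \<le> k" "k \<le> b" "b \<le> n" "\<forall>i\<in>{1..b}. x i" "b = n \<or> \<not> x (Suc b)"
  shows "first_late_run k n x 0 1 b"
proof -
  \<comment> \<open>A longer run would contain trial \<open>Suc b\<close>, which is a failure or
    lies beyond \<open>n\<close>.\<close>
  have "b' = b" if l: "late_run k n x 0 a' b'" "a' \<le> 1" "b \<le> b'" for a' b'
  proof (rule ccontr)
    assume "b' \<noteq> b"
    with l have "Suc b \<in> {a'..b'}" "b \<noteq> n"
      by (auto simp: late_run_def)
    with l assms(5) show False
      by (auto simp: late_run_def)
  qed
  moreover have "1 \<le> a'" if "late_run k n x 0 a' b'" for a' b'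
    using that by (simp add: late_run_def)
  moreover have "late_run k n x 0 1 b"
    using assms by (simp add: late_run_def)
  ultimately have "maximal_late_run k n x 0 1 b"
    unfolding maximal_late_run_alt by (metis antisym)
  then show ?thesis
    by (auto simp: first_late_run_def maximal_late_run_def late_run_def)
qed

lemma first_late_run_skip:
  assumes "\<And>a b. late_run k n x 0 a b \<Longrightarrow> s < a"
  shows "first_late_run k n x 0 = first_late_run k n x s"
proof -
  have "late_run k n x 0 = late_run k n x s"
    using assms by (intro ext) (auto simp: late_run_def)
  then show ?thesis
    by (intro ext) (simp add: first_late_run_def maximal_late_run_def)
qed

lemma late_run_cong:
  assumes "\<forall>i\<in>{1..n}. x i = y i"
  shows "late_run k n x = late_run k n y"
  using assms by (intro ext) (auto simp: late_run_def)

lemma first_late_run_cong: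
  assumes "\<forall>i\<in>{1..n}. x i = y i"
  shows "first_late_run k n x = first_late_run k n y"
  by (intro ext) (simp add: first_late_run_def maximal_late_run_def late_run_cong[OF assms])

section \<open>Success runs described by restarting\<close>

text \<open>The success runs of the process that is started afresh after trial \<open>r\<close>.\<close>

inductive run_after :: "nat \<Rightarrow> nat \<Rightarrow> nat \<Rightarrow> (nat \<Rightarrow> bool) \<Rightarrow> nat \<Rightarrow> nat \<Rightarrow> nat \<Rightarrow> bool"
  for k g n x where
  here: "first_late_run k n x r a b \<Longrightarrow> run_after k g n x r a b"
| later: "first_late_run k n x r a m \<Longrightarrow> run_after k g n x (m + g) a' b' \<Longrightarrow>
    run_after k g n x r a' b'"

text \<open>\<open>run_after\<close> is built by prepending a run, \<open>success_run\<close> by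
  appending one; this rule bridges the two inductions.\<close>

lemma run_after_snoc:
  assumes "run_after k g n x r a m" "first_late_run k n x (m + g) a' b'"
  shows "run_after k g n x r a' b'"
  using assms by induction (auto intro: run_after.intros)

lemma success_run_imp_run_after: "success_run k g n x j a b \<Longrightarrow> run_after k g n x 0 a b"
  by (induction rule: success_run.induct) (auto intro: here run_after_snoc)

text \<open>The start \<open>r\<close> changes along the induction, so the claim is generalised from
  0 to all points at which the process can restart.\<close>

lemma run_after_imp_success_run:
  assumes "run_after k g n x r a b" "r = 0 \<or> (\<exists>j c m. success_run k g n x j c m \<and> r = m + g)"
  shows "\<exists>j. success_run k g n x j a b"
  using assms by induction (blast intro: success_run.intros)+

lemma ex_success_run_iff: "(\<exists>j. success_run k g n x j a b) \<longleftrightarrow> run_after k g n x 0 a b"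
  using success_run_imp_run_after run_after_imp_success_run by blast

lemma run_after_imp_late_run: "run_after k g n x r a b \<Longrightarrow> \<exists>r'. late_run k n x r' a b"
  by (induction rule: run_after.induct) (auto dest: first_late_run_imp_late_run)

lemma run_after_cong:
  assumes "\<forall>i\<in>{1..n}. x i = y i"
  shows "run_after k g n x = run_after k g n y"
proof -
  have "run_after k g n y r a b"
    if "run_after k g n x r a b" "first_late_run k n x = first_late_run k n y" for x y r a b
    using that by induction (auto intro: run_after.intros)
  then show ?thesis
    using first_late_run_cong[OF assms] by (intro ext) metis
qed

lemma run_after_shift_down:
  assumes "run_after k g n x r' a' b'" "r' = r + s"
  shows "\<exists>a b. a' = a + s \<and> b' = b + s \<and> run_after k g (n - s) (\<lambda>i. x (i + s)) r a b"
  using assms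
proof (induction arbitrary: r)
  case (here r' a' b')
  then have "s \<le> a'" "s \<le> b'"
    using late_run_ge first_late_run_imp_late_run by blast+
  with here show ?case
    by (metis first_late_run_shift run_after.here le_add_diff_inverse2)
next
  case (later r' c m a' b')
  then have "s \<le> c" "s \<le> m"
    using late_run_ge first_late_run_imp_late_run by blast+
  then obtain c' m' where cm: "c = c' + s" "m = m' + s"
    by (metis le_add_diff_inverse2)
  \<comment> \<open>Since \<open>m + g = (m' + g) + s\<close>, the induction hypothesis applies with
    restart point \<open>m' + g\<close>.\<close>
  then obtain a b where "a' = a + s" "b' = b + s"
    "run_after k g (n - s) (\<lambda>i. x (i + s)) (m' + g) a b"
    using later.IH[of "m' + g"] by auto
  moreover have "first_late_run k (n - s) (\<lambda>i. x (i + s)) r c' m'"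
    using later.hyps(1) unfolding later.prems cm first_late_run_shift .
  ultimately show ?case
    by (blast intro: run_after.later)
qed

lemma run_after_shift_up:
  assumes "run_after k g (n - s) (\<lambda>i. x (i + s)) r a b"
  shows "run_after k g n x (r + s) (a + s) (b + s)"
  using assms
proof induction
  case (here r a b)
  then show ?case
    by (simp add: first_late_run_shift run_after.here)
next
  case (later r a m a' b')
  then show ?case
    by (metis first_late_run_shift run_after.later add.assoc add.commute)
qed

section \<open>Long runs, by the outcome of the first trials\<close>

definition long_run_after :: "nat \<Rightarrow> nat \<Rightarrow> nat \<Rightarrow> nat \<Rightarrow> (nat \<Rightarrow> bool) \<Rightarrow> nat \<Rightarrow> bool" where
  "long_run_after k g t n x r \<longleftrightarrow> (\<exists>a b. run_after k g n x r a b \<and> t \<le> card {a..b})"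

lemma long_run_after_shift:
  "long_run_after k g t n x s \<longleftrightarrow> long_run_after k g t (n - s) (\<lambda>i. x (i + s)) 0"
proof
  assume "long_run_after k g t n x s"
  then show "long_run_after k g t (n - s) (\<lambda>i. x (i + s)) 0"
    unfolding long_run_after_def using run_after_shift_down[where r = 0] by fastforce
next
  assume "long_run_after k g t (n - s) (\<lambda>i. x (i + s)) 0"
  then show "long_run_after k g t n x s"
    unfolding long_run_after_def using run_after_shift_up[where r = 0] by fastforce
qed

lemma longest_run_ge_iff:
  assumes "1 \<le> t"
  shows "t \<le> longest_run k g n x \<longleftrightarrow> long_run_after k g t n x 0"
proof -
  define C where "C = {card {a..b} | j a b. success_run k g n x j a b}"
  have C: "C = {card {a..b} | a b. run_after k g n x 0 a b}"
    unfolding C_def ex_success_run_iff[symmetric] by blast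
  \<comment> \<open>Every run lies within the \<open>n\<close> trials; this bounds its length and
    makes \<open>C\<close> finite, as \<open>Max_ge_iff\<close> requires.\<close>
  have "C \<subseteq> {..n}"
    unfolding C using run_after_imp_late_run by (fastforce simp: late_run_def)
  then have "finite C"
    by (rule finite_subset) simp
  then have "t \<le> longest_run k g n x \<longleftrightarrow> (\<exists>c\<in>insert 0 C. t \<le> c)"
    unfolding longest_run_def C_def[symmetric] by (subst Max_ge_iff) auto
  also have "\<dots> \<longleftrightarrow> (\<exists>c\<in>C. t \<le> c)"
    using assms by auto
  also have "\<dots> \<longleftrightarrow> long_run_after k g t n x 0"
    unfolding C long_run_after_def by blast
  finally show ?thesis .
qed

lemma long_run_after_initial_long:
  assumes "1 \<le> k" "k \<le> t" "t \<le> n" "\<forall>i\<in>{1..t}. x i"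
  shows "long_run_after k g t n x 0"
proof -
  define P where "P b \<longleftrightarrow> b \<le> n \<and> (\<forall>i\<in>{1..b}. x i)" for b
  \<comment> \<open>The maximal initial block of successes: it contains the first \<open>t\<close>
    trials and is the first success run.\<close>
  define b where "b = (GREATEST b. P b)"
  have "P t"
    using assms by (simp add: P_def)
  moreover have bound: "\<And>b. P b \<Longrightarrow> b \<le> n"
    by (simp add: P_def)
  ultimately have b: "P b" "t \<le> b"
    unfolding b_def by (auto intro: GreatestI_nat Greatest_le_nat)
  have "\<not> P (Suc b)"
    unfolding b_def using bound by (metis Greatest_le_nat Suc_n_not_le_n)
  then have "b = n \<or> \<not> x (Suc b)"
    using b(1) by (auto simp: P_def le_Suc_eq)
  then have "first_late_run k n x 0 1 b"
    using b assms by (intro first_late_run_initial) (auto simp: P_def)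
  then show ?thesis
    unfolding long_run_after_def using b(2) by (intro exI[of _ 1] exI[of _ b]) (simp add: here)
qed

text \<open>As \<open>i < k\<close>, a run of length at least \<open>k\<close> that begins at or
  before trial \<open>Suc i\<close> would contain that failure.\<close>

lemma long_run_after_initial_short:
  assumes "i < k" "\<not> x (Suc i)"
  shows "long_run_after k g t n x 0 \<longleftrightarrow> long_run_after k g t n x (Suc i)"
proof -
  have "Suc i < a" if l: "late_run k n x 0 a b" for a b
  proof (rule ccontr)
    assume "\<not> Suc i < a"
    with l assms(1) have "Suc i \<in> {a..b}"
      by (auto simp: late_run_def)
    with l assms(2) show False
      by (auto simp: late_run_def)
  qed
  then have "first_late_run k n x 0 = first_late_run k n x (Suc i)"
    by (rule first_late_run_skip)
  \<comment> \<open>\<open>run_after\<close> consults its starting point only through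
    \<open>first_late_run\<close>, so one unfolding on each side suffices.\<close>
  then have "run_after k g n x 0 = run_after k g n x (Suc i)"
    by (intro ext) (subst (1 2) run_after.simps, simp)
  then show ?thesis
    by (simp add: long_run_after_def)
qed

lemma long_run_after_initial_medium:
  assumes "1 \<le> k" "k \<le> i" "i < t" "i < n" "\<forall>j\<in>{1..i}. x j" "\<not> x (Suc i)"
  shows "long_run_after k g t n x 0 \<longleftrightarrow> long_run_after k g t n x (i + g)"
proof -
  have f: "first_late_run k n x 0 1 i"
    using assms by (intro first_late_run_initial) auto
  \<comment> \<open>Uniqueness of the first run forces the rule \<open>later\<close> to restart
    exactly at \<open>i + g\<close>. The run \<open>1, ..., i\<close> itself is shorter than
    \<open>t\<close>.\<close>
  have "run_after k g n x 0 a b \<longleftrightarrow> a = 1 \<and> b = i \<or> run_after k g n x (i + g) a b" for a b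
    by (subst run_after.simps) (metis f first_late_run_unique)
  then show ?thesis
    unfolding long_run_after_def using assms(3) by auto
qed

section \<open>Probabilities over natural indices\<close>

definition long_run_prob :: "real \<Rightarrow> nat \<Rightarrow> nat \<Rightarrow> nat \<Rightarrow> nat \<Rightarrow> real" where
  "long_run_prob p k g t n =
     measure_pmf.prob (bernoulli_trials p n) {x. long_run_after k g t n x 0}"

lemma not_long_run_after:
  assumes "n < t"
  shows "\<not> long_run_after k g t n x 0"
proof
  assume "long_run_after k g t n x 0"
  then obtain a b r where "late_run k n x r a b" "t \<le> card {a..b}"
    unfolding long_run_after_def using run_after_imp_late_run by blast
  with assms show False
    by (auto simp: late_run_def)
qed

lemma long_run_prob_eq_0: "n < t \<Longrightarrow> long_run_prob p k g t n = 0"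
  by (simp add: long_run_prob_def not_long_run_after)

text \<open>\<open>nat\<close> sends nonpositive indices to 0, where \<open>long_run_prob\<close>
  vanishes because \<open>1 \<le> t\<close>; this absorbs the convention for
  \<open>n \<le> 0\<close>.\<close>

lemma run_prob_eq:
  assumes "1 \<le> t"
  shows "run_prob p k g n t = long_run_prob p k g t (nat n)"
proof (cases "n \<le> 0")
  case True
  then show ?thesis
    using assms by (simp add: run_prob_def long_run_prob_eq_0)
next
  case False
  then show ?thesis
    by (simp add: run_prob_def long_run_prob_def longest_run_ge_iff[OF assms])
qed

section \<open>Independence of blocks of trials\<close>

lemma bernoulli_trials_shift:
  "bernoulli_trials p m =
   map_pmf (\<lambda>x i. x (i + s))
     (Pi_pmf {Suc s..s + m} False (\<lambda>_. bernoulli_pmf p))"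
proof -
  have "bij_betw (\<lambda>i. i + s) {1..m} {Suc s..s + m}"
    by (rule bij_betw_byWitness[where f' = "\<lambda>i. i - s"]) auto
  then show ?thesis
    unfolding bernoulli_trials_def
    by (subst Pi_pmf_bij_betw[where h = "\<lambda>i. i + s" and B = "{Suc s..s + m}"])
      (auto simp: comp_def)
qed

text \<open>Cutting both sets down to the supports makes them countable and leaves all probabilities
  unchanged.\<close>

lemma prob_pair_pmf_Times:
  "measure_pmf.prob (pair_pmf M N) (A \<times> B) = measure_pmf.prob M A * measure_pmf.prob N B"
proof -
  have "measure_pmf.prob (pair_pmf M N) (A \<times> B) =
      measure_pmf.prob (pair_pmf M N) ((A \<inter> set_pmf M) \<times> (B \<inter> set_pmf N))"
    by (subst measure_Int_set_pmf[symmetric]) (simp add: Times_Int_Times)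
  also have "\<dots> = measure_pmf.prob M (A \<inter> set_pmf M) * measure_pmf.prob N (B \<inter> set_pmf N)"
    by (rule measure_pmf_prob_product) auto
  finally show ?thesis
    by (simp add: measure_Int_set_pmf)
qed

lemma prob_bernoulli_trials_split:
  assumes Q: "\<And>x y. (\<forall>i\<in>{1..s}. x i = y i) \<Longrightarrow> Q x = Q y"
    and R: "\<And>x y. (\<forall>i\<in>{1..m}. x i = y i) \<Longrightarrow> R x = R y"
  shows "measure_pmf.prob (bernoulli_trials p (s + m)) {x. Q x \<and> R (\<lambda>i. x (i + s))} =
    measure_pmf.prob (bernoulli_trials p s) {x. Q x} *
    measure_pmf.prob (bernoulli_trials p m) {x. R x}"
proof -
  let ?A = "{1..s}" and ?B = "{Suc s..s + m}"
  let ?P = "\<lambda>A. Pi_pmf A False (\<lambda>_. bernoulli_pmf p)"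
  let ?glue = "\<lambda>(x, y) i. if i \<in> ?A then x i else y i :: bool"
  have "{1..s + m} = ?A \<union> ?B"
    by auto
  then have "bernoulli_trials p (s + m) = map_pmf ?glue (pair_pmf (?P ?A) (?P ?B))"
    unfolding bernoulli_trials_def by (simp only:) (rule Pi_pmf_union, auto)
  \<comment> \<open>Each predicate sees only one component of a glued outcome, so the preimage of
    the joint event is a rectangle.\<close>
  moreover have QR: "Q (?glue (x, y)) = Q x" "R (\<lambda>i. ?glue (x, y) (i + s)) = R (\<lambda>i. y (i + s))" for x y
    by (rule Q R; simp)+
  have "?glue -` {x. Q x \<and> R (\<lambda>i. x (i + s))} = {x. Q x} \<times> {y. R (\<lambda>i. y (i + s))}"
    by (rule set_eqI) (simp only: split_paired_all vimage_eq mem_Collect_eq mem_Sigma_iff QR)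
  ultimately have "measure_pmf.prob (bernoulli_trials p (s + m)) {x. Q x \<and> R (\<lambda>i. x (i + s))} =
      measure_pmf.prob (pair_pmf (?P ?A) (?P ?B)) ({x. Q x} \<times> {y. R (\<lambda>i. y (i + s))})"
    by simp
  also have "\<dots> = measure_pmf.prob (?P ?A) {x. Q x} * measure_pmf.prob (?P ?B) {y. R (\<lambda>i. y (i + s))}"
    by (rule prob_pair_pmf_Times)
  also have "measure_pmf.prob (?P ?B) {y. R (\<lambda>i. y (i + s))} =
      measure_pmf.prob (bernoulli_trials p m) {x. R x}"
    by (simp add: bernoulli_trials_shift[of p m s] vimage_def)
  finally show ?thesis
    by (simp add: bernoulli_trials_def)
qed

lemma prob_bernoulli_trials_Ball:
  assumes "p \<in> {0..1}" "t \<le> n"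
  shows "measure_pmf.prob (bernoulli_trials p n) {x. \<forall>i\<in>{1..t}. x i} = p ^ t"
proof -
  \<comment> \<open>The event is a product set; the factors \<open>UNIV\<close> beyond trial
    \<open>t\<close> contribute probability 1.\<close>
  let ?B = "\<lambda>j. if j \<le> t then {True} else UNIV"
  have "{x. \<forall>i\<in>{1..t}. x i} = Pi {1..n} ?B"
    using assms(2) by (auto simp: Pi_def)
  then have "measure_pmf.prob (bernoulli_trials p n) {x. \<forall>i\<in>{1..t}. x i} =
      (\<Prod>j\<in>{1..n}. measure_pmf.prob (bernoulli_pmf p) (?B j))"
    unfolding bernoulli_trials_def by (simp only:) (rule measure_Pi_pmf_Pi, simp)
  also have "\<dots> = (\<Prod>j\<in>{1..t}. p)"
    using assms by (intro prod.mono_neutral_cong_right) (auto simp: measure_pmf_single)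
  finally show ?thesis
    by simp
qed

section \<open>Position of the first failure\<close>

definition first_failure :: "nat \<Rightarrow> (nat \<Rightarrow> bool) \<Rightarrow> bool" where
  "first_failure i x \<longleftrightarrow> (\<forall>j\<in>{1..i}. x j) \<and> \<not> x (Suc i)"

text \<open>The event is the difference of two nested events, with probabilities
  \<open>p ^ i\<close> and \<open>p ^ Suc i\<close>.\<close>

lemma prob_bernoulli_trials_first_failure:
  assumes "p \<in> {0..1}" "i < n"
  shows "measure_pmf.prob (bernoulli_trials p n) {x. first_failure i x} = (1 - p) * p ^ i"
proof -
  let ?S = "{x. \<forall>j\<in>{1..i}. x j}" and ?T = "{x. \<forall>j\<in>{1..Suc i}. x j}"
  have "{x. first_failure i x} = ?S - ?T"
    by (auto simp: first_failure_def atLeastAtMostSuc_conv)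
  also have "measure_pmf.prob (bernoulli_trials p n) \<dots> =
      measure_pmf.prob (bernoulli_trials p n) ?S - measure_pmf.prob (bernoulli_trials p n) ?T"
    by (rule measure_pmf.finite_measure_Diff) auto
  also have "\<dots> = p ^ i - p ^ Suc i"
    using assms by (simp only: prob_bernoulli_trials_Ball Suc_leI less_imp_le)
  finally show ?thesis
    by (simp add: algebra_simps)
qed

text \<open>By \<open>i < s\<close> the failure at trial \<open>Suc i\<close> lies in the first
  \<open>s\<close> trials, so it is independent of the process restarted after trial
  \<open>s\<close>.\<close>

lemma prob_first_failure_long_run_after:
  assumes "p \<in> {0..1}" "1 \<le> t" "i < s"
  shows "measure_pmf.prob (bernoulli_trials p n) {x. first_failure i x \<and> long_run_after k g t n x s}
    = (1 - p) * (p ^ i * long_run_prob p k g t (n - s))"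
proof (cases "s \<le> n")
  case True
  then obtain m where n: "n = s + m"
    using le_Suc_ex by blast
  have "measure_pmf.prob (bernoulli_trials p (s + m))
      {x. first_failure i x \<and> long_run_after k g t m (\<lambda>i. x (i + s)) 0} =
    measure_pmf.prob (bernoulli_trials p s) {x. first_failure i x} * long_run_prob p k g t m"
    unfolding long_run_prob_def
  proof (rule prob_bernoulli_trials_split)
    show "first_failure i x = first_failure i y" if "\<forall>i\<in>{1..s}. x i = y i" for x y
      using that assms by (auto simp: first_failure_def)
    show "long_run_after k g t m x 0 = long_run_after k g t m y 0"
      if "\<forall>i\<in>{1..m}. x i = y i" for x y
      unfolding long_run_after_def run_after_cong[OF that] ..
  qed
  then show ?thesis
    using assms by (simp add: n long_run_after_shift[of k g t _ _ s] prob_bernoulli_trials_first_failure)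
next
  \<comment> \<open>No trial remains after \<open>s\<close>, so no run of positive length
    \<open>t\<close> can occur and both sides are 0.\<close>
  case False
  then show ?thesis
    using assms by (simp add: long_run_after_shift[of k g t n _ s] not_long_run_after long_run_prob_eq_0)
qed

lemma ex_first_failure: "\<not> (\<forall>i\<in>{1..t}. x i) \<Longrightarrow> \<exists>i<t. first_failure i x"
proof (induction t)
  case (Suc t)
  show ?case
  proof (cases "\<forall>i\<in>{1..t}. x i")
    case True
    with Suc.prems have "first_failure t x"
      by (simp add: first_failure_def atLeastAtMostSuc_conv)
    then show ?thesis
      by blast
  next
    case False
    then show ?thesis
      using Suc.IH less_Suc_eq by blast
  qed
qed simp

lemma first_failure_unique:
  assumes "first_failure i x" "first_failure j x"
  shows "i = j"
proof -
  have "\<not> i < j" if "first_failure i x" "first_failure j x" for i j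
  proof
    assume "i < j"
    then have "Suc i \<in> {1..j}"
      by simp
    with that show False
      unfolding first_failure_def by blast
  qed
  from this[of i j] this[of j i] assms show ?thesis
    by simp
qed

section \<open>The recursion\<close>

lemma long_run_prob_rec:
  assumes "1 \<le> k" "1 \<le> g" "k \<le> t" "t \<le> n" "p \<in> {0..1}"
  shows "long_run_prob p k g t n =
    (1 - p) * (\<Sum>i = 0..<k. p ^ i * long_run_prob p k g t (n - Suc i)) +
    (1 - p) * (\<Sum>i = k..<t. p ^ i * long_run_prob p k g t (n - (i + g))) + p ^ t"
proof -
  let ?P = "measure_pmf.prob (bernoulli_trials p n)"
  \<comment> \<open>The trial after which the process restarts: the failure itself if no run has
    formed, otherwise the end of the gap. In the latter case \<open>1 \<le> g\<close> gives
    \<open>i < s i\<close>.\<close>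
  define s where "s i = (if i < k then Suc i else i + g)" for i
  define E where "E i = {x. first_failure i x \<and> long_run_after k g t n x (s i)}" for i
  define T where "T = {x :: nat \<Rightarrow> bool. \<forall>i\<in>{1..t}. x i}"
  have restart: "long_run_after k g t n x 0 \<longleftrightarrow> long_run_after k g t n x (s i)"
    if "first_failure i x" "i < t" for i x
    using that assms long_run_after_initial_short[of i k x g t n]
      long_run_after_initial_medium[of k i t n x g]
    by (auto simp: s_def first_failure_def)
  have "long_run_after k g t n x 0 \<longleftrightarrow> x \<in> (\<Union>i<t. E i) \<union> T" for x
  proof (cases "x \<in> T")
    case True
    then show ?thesis
      using long_run_after_initial_long[of k t n x g] assms by (simp add: T_def)
  next
    case False
    then obtain i where i: "i < t" "first_failure i x"
      using ex_first_failure[of t x] by (auto simp: T_def)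
    \<comment> \<open>As the first failure is unique, the union over \<open>j\<close> collapses to
      the index \<open>i\<close>.\<close>
    have "x \<in> E j \<longleftrightarrow> j = i \<and> long_run_after k g t n x (s i)" for j
      using i(2) first_failure_unique[of i x j] by (auto simp: E_def)
    then show ?thesis
      using False i(1) restart[OF i(2,1)] by auto
  qed
  then have "{x. long_run_after k g t n x 0} = (\<Union>i<t. E i) \<union> T"
    by blast
  then have "long_run_prob p k g t n = ?P ((\<Union>i<t. E i) \<union> T)"
    by (simp only: long_run_prob_def)
  \<comment> \<open>Disjoint: for \<open>i < t\<close>, outcomes in \<open>E i\<close> have a
    failure among the first \<open>t\<close> trials.\<close>
  also have "\<dots> = ?P (\<Union>i<t. E i) + ?P T"
    by (rule measure_pmf.finite_measure_Union) (auto simp: E_def T_def first_failure_def Suc_le_eq)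
  also have "?P (\<Union>i<t. E i) = (\<Sum>i<t. ?P (E i))"
    by (rule measure_pmf.finite_measure_finite_Union)
      (auto simp: E_def disjoint_family_on_def dest: first_failure_unique)
  also have "\<dots> = (\<Sum>i = 0..<t. (1 - p) * (p ^ i * long_run_prob p k g t (n - s i)))"
    unfolding E_def lessThan_atLeast0 using assms
    by (intro sum.cong prob_first_failure_long_run_after) (auto simp: s_def)
  also have "\<dots> = (\<Sum>i = 0..<k. (1 - p) * (p ^ i * long_run_prob p k g t (n - s i))) +
      (\<Sum>i = k..<t. (1 - p) * (p ^ i * long_run_prob p k g t (n - s i)))"
    using assms by (simp add: sum.atLeastLessThan_concat)
  also have "?P T = p ^ t"
    unfolding T_def using assms by (intro prob_bernoulli_trials_Ball)
  finally show ?thesis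
    by (simp add: s_def sum_distrib_left)
qed

theorem proposition7p1:
  fixes k g t :: nat and p q :: real
  assumes "k \<ge> 1" and "g \<ge> 1" and "t \<ge> k"
    and "p \<in> {0<..<1}" and "q = 1 - p"
  shows "(\<forall>n::int. n > int t \<longrightarrow>
            run_prob p k g n t =
              q * (\<Sum>i = 0..<k. p ^ i * run_prob p k g (n - int i - 1) t)
              + q * (\<Sum>i = k..<t. p ^ i * run_prob p k g (n - int i - int g) t)
              + p ^ t)
         \<and> run_prob p k g (int t) t = p ^ t
         \<and> (\<forall>n::int. n < int t \<longrightarrow> run_prob p k g n t = 0)"
proof (intro conjI allI impI)
  have t: "1 \<le> t" and p: "p \<in> {0..1}"
    using assms by auto
  note rec = long_run_prob_rec[OF assms(1-3) _ p]
  show "run_prob p k g n t = q * (\<Sum>i = 0..<k. p ^ i * run_prob p k g (n - int i - 1) t)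
      + q * (\<Sum>i = k..<t. p ^ i * run_prob p k g (n - int i - int g) t) + p ^ t"
    if "n > int t" for n
  proof -
    \<comment> \<open>Truncated subtraction matches \<open>nat\<close> of the integer difference,
      both being 0 when that difference is negative.\<close>
    have "nat (n - int i - 1) = nat n - Suc i" "nat (n - int i - int g) = nat n - (i + g)" for i
      by auto
    then show ?thesis
      using rec[of "nat n"] that by (simp add: run_prob_eq[OF t] assms(5))
  qed
  \<comment> \<open>The recursion also holds at \<open>n = t\<close>. There \<open>1 \<le> g\<close>
    and \<open>1 \<le> t\<close> make every index on the right smaller than \<open>t\<close>, so
    both sums vanish.\<close>
  show "run_prob p k g (int t) t = p ^ t"
    using rec[of t] assms(2) t by (simp add: run_prob_eq long_run_prob_eq_0)
  show "run_prob p k g n t = 0" if "n < int t" for n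
    using that t by (simp add: run_prob_eq long_run_prob_eq_0 nat_less_iff)
qed

end
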